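(* Let $T>0$ and let $p_H^r(t)\in\mathbb{R}^3$ and $f_c^r(t)\in\mathbb{R}^3\setminus\{0\}$, $t\in[0,T]$, be a time-varying human position reference and a time-varying desired cable force, with $z_W^\top p_H^r(T)=0$ and $f_c^r(T)=f_z z_W$, $0<f_z<m_Hg$. Set $p_R^r(t)=p_H^r(t)+f_c^r(t)\left(\frac1{k_c}+\frac{\bar l_c}{\|f_c^r(t)\|}\right)$. Consider the system with state $x=[p_H^\top\ v_H^\top\ p_R^\top\ v_R^\top]^\top\in\mathcal{X}$, subject to an additional human force $u_H\in\mathbb{R}^3$, with dynamics $$\dot p_H=v_H,\quad \dot v_H=\tfrac1{m_H}\left(-m_Hg\,z_W-B_Hv_H+f_c+f_g+u_H\right),\quad \dot p_R=v_R,\quad \dot v_R=M_A^{-1}\left(-B_Av_R-f_c+u_A\right),$$ under the control law $$u_A(t)=K_H\,(p_R^r(T)-p_R(t))+f_c^r(T)+u_A'(t),\qquad u_A'(t)=K_H\,(p_R^r(t)-p_R^r(T))+f_c^r(t)-f_c^r(T).$$ Then this system is output-strictly passive with respect to the input-output pair $(u,y)=\left([u_A'^\top\ u_H^\top]^\top,\ [v_R^\top\ v_H^\top]^\top\right)$, with storage function $$V(x)=\tfrac12\left(m_Hv_H^\top v_H+v_R^\top M_Av_R+e^\top K_He\right)+\int_{l_{c0}}^{\|l_c\|}t_c(\tau)\,d\tau-l_c^\top f_c^r(T)+V_0,\qquad e=p_R^r(T)-p_R,\ \ l_c=p_R-p_H,$$ where $l_{c0}=\|l_c(0)\|$ and $V_0$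 is the constant such that $V(\bar x)=0$ for $\bar x=[p_H^r(T)^\top\ 0^\top\ p_R^r(T)^\top\ 0^\top]^\top$.
   Context: Constants: $m_H,g,k_c,\bar l_c,k_H>0$; $B_H\in\mathbb{R}^{3\times3}$ positive definite; $M_A,B_A\in\mathbb{R}^{3\times 3}$ positive definite diagonal; $K_H=\mathrm{diag}(k_H,k_H,0)$. $\{x_W,y_W,z_W\}$ is the canonical orthonormal basis of $\mathbb{R}^3$, with $z_W$ pointing vertically upward. $p_H,v_H\in\mathbb{R}^3$ are the position and velocity of the human (hand), and $p_R,v_R\in\mathbb{R}^3$ those of the aerial robot. Cable force: let $l_c=p_R-p_H$ and define the tension $t_c(\ell)=k_c(\ell-\bar l_c)$ if $\ell>\bar l_c$ and $t_c(\ell)=0$ otherwise. The cable force on the human is $f_c=t_c(\|l_c\|)\,l_c/\|l_c\|$ (equal to $0$ when $\|l_c\|\le\bar l_c$, including $l_c=0$). The force on the robot is $-f_c$. Ground constraint: the ground is flat and horizontal and the human is constrained to it, i.e. the state space is $\mathcal{X}=\{x\in\mathbb{R}^{12}: z_W^\top p_H=0,\ z_W^\top v_H=0\}$. The ground reaction $f_g$ is vertical, $f_g=\lambda z_W$, where the scalar $\lambda$ is the value for which $z_W^\top\dot v_H=0$. It is a standing assumption that the human stays on the ground (the reaction intensity satisfies $\lambda\ge 0$; the human is never lifted). Output-strict passivity (Khalil): a system with input $u$ and output $y$ of the same dimension is output-strictly passive with storage function $V$ if $V$ is continuously differentiable and positive semidefinite ($V\ge0$ on $\mathcal{X}$), and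 there is a function $\phi$ with $y^\top\phi(y)>0$ for all $y\neq0$ such that, along the system dynamics, $\dot V\le u^\top y-y^\top\phi(y)$ for every state and every input value. *)

theory Defs
  imports "HOL-Analysis.Analysis"
begin

section \<open>Output-strict passivity\<close>

text \<open>
  The system is \<open>x' = F x u\<close>, \<open>y = h x\<close>, on the state space \<open>X\<close>. The derivative of \<open>V\<close> along the
  dynamics is \<open>V' x (F x u)\<close>. The storage function is a function on the ambient space, and
  continuous differentiability is required there, because \<open>X\<close> need not be open.
\<close>

definition output_strictly_passive ::
  "('x::real_normed_vector) set \<Rightarrow> ('x \<Rightarrow> 'u \<Rightarrow> 'x) \<Rightarrow> ('x \<Rightarrow> 'u::real_inner) \<Rightarrow> ('x \<Rightarrow> real) \<Rightarrow> bool"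
where
  "output_strictly_passive X F h V \<longleftrightarrow>
     (\<exists>V' :: 'x \<Rightarrow> 'x \<Rightarrow>\<^sub>L real.
        (\<forall>x. (V has_derivative blinfun_apply (V' x)) (at x)) \<and> continuous_on UNIV V' \<and>
        (\<forall>x\<in>X. 0 \<le> V x) \<and>
        (\<exists>\<phi> :: 'u \<Rightarrow> 'u.
           (\<forall>y. y \<noteq> 0 \<longrightarrow> 0 < y \<bullet> \<phi> y) \<and>
           (\<forall>x\<in>X. \<forall>u. blinfun_apply (V' x) (F x u) \<le> u \<bullet> h x - h x \<bullet> \<phi> (h x))))"


section \<open>Matrices\<close>

text \<open>Symmetry is deliberately not part of positive definiteness.\<close>

definition pos_def :: "real^'n^'n \<Rightarrow> bool" where
  "pos_def A \<longleftrightarrow> (\<forall>x. x \<noteq> 0 \<longrightarrow> 0 < x \<bullet> (A *v x))"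

definition diagonal :: "real^'n^'n \<Rightarrow> bool" where
  "diagonal A \<longleftrightarrow> (\<forall>i j. i \<noteq> j \<longrightarrow> A $ i $ j = 0)"

definition K_H :: "real \<Rightarrow> real^3^3" where
  "K_H k = vector [vector [k, 0, 0], vector [0, k, 0], vector [0, 0, 0]]"


section \<open>Human, cable and aerial robot\<close>

definition z_W :: "real^3" where
  "z_W = axis 3 1"

text \<open>A state is \<open>(p\<^sub>H, v\<^sub>H, p\<^sub>R, v\<^sub>R)\<close>.\<close>

type_synonym state = "(real^3) \<times> (real^3) \<times> (real^3) \<times> (real^3)"

abbreviation (input) p_H :: "state \<Rightarrow> real^3" where "p_H x \<equiv> fst x"
abbreviation (input) v_H :: "state \<Rightarrow> real^3" where "v_H x \<equiv> fst (snd x)"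
abbreviation (input) p_R :: "state \<Rightarrow> real^3" where "p_R x \<equiv> fst (snd (snd x))"
abbreviation (input) v_R :: "state \<Rightarrow> real^3" where "v_R x \<equiv> snd (snd (snd x))"

definition state_space :: "state set" where
  "state_space = {x. z_W \<bullet> p_H x = 0 \<and> z_W \<bullet> v_H x = 0}"

definition cable :: "state \<Rightarrow> real^3" where
  "cable x = p_R x - p_H x"

definition tension :: "real \<Rightarrow> real \<Rightarrow> real \<Rightarrow> real" where
  "tension kc lbar l = (if l > lbar then kc * (l - lbar) else 0)"

definition cable_force :: "real \<Rightarrow> real \<Rightarrow> real^3 \<Rightarrow> real^3" where
  "cable_force kc lbar l = tension kc lbar (norm l) *\<^sub>R (l /\<^sub>R norm l)"

definition human_acc ::
  "real \<Rightarrow> real \<Rightarrow> real^3^3 \<Rightarrow> real^3 \<Rightarrow> real^3 \<Rightarrow> real^3 \<Rightarrow> real^3 \<Rightarrow> real^3" where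
  "human_acc mH g BH v fc fg uH =
     (1 / mH) *\<^sub>R (- ((mH * g) *\<^sub>R z_W) - BH *v v + fc + fg + uH)"

definition ground_reaction ::
  "real \<Rightarrow> real \<Rightarrow> real^3^3 \<Rightarrow> real^3 \<Rightarrow> real^3 \<Rightarrow> real^3 \<Rightarrow> real^3" where
  "ground_reaction mH g BH v fc uH =
     (THE r. z_W \<bullet> human_acc mH g BH v fc (r *\<^sub>R z_W) uH = 0) *\<^sub>R z_W"

text \<open>The right-hand side of the dynamics for a robot force \<open>uA\<close> and a human force \<open>uH\<close>.\<close>

definition plant ::
  "real \<Rightarrow> real \<Rightarrow> real \<Rightarrow> real \<Rightarrow> real^3^3 \<Rightarrow> real^3^3 \<Rightarrow> real^3^3 \<Rightarrow>
   state \<Rightarrow> real^3 \<Rightarrow> real^3 \<Rightarrow> state"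
where
  "plant mH g kc lbar BH MA BA x uA uH =
     (let fc = cable_force kc lbar (cable x);
          fg = ground_reaction mH g BH (v_H x) fc uH
      in (v_H x,
          human_acc mH g BH (v_H x) fc fg uH,
          v_R x,
          matrix_inv MA *v (- (BA *v v_R x) - fc + uA)))"


section \<open>References and control law\<close>

definition robot_ref ::
  "real \<Rightarrow> real \<Rightarrow> (real \<Rightarrow> real^3) \<Rightarrow> (real \<Rightarrow> real^3) \<Rightarrow> real \<Rightarrow> real^3" where
  "robot_ref kc lbar pHr fcr t = pHr t + (1 / kc + lbar / norm (fcr t)) *\<^sub>R fcr t"

text \<open>The control law \<open>u\<^sub>A\<close> as a function of the robot position \<open>pR\<close> and of the value \<open>w\<close> of \<open>u'\<^sub>A\<close>.\<close>

definition control_law ::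
  "real \<Rightarrow> (real \<Rightarrow> real^3) \<Rightarrow> (real \<Rightarrow> real^3) \<Rightarrow> real \<Rightarrow> real^3 \<Rightarrow> real^3 \<Rightarrow> real^3" where
  "control_law kH pRr fcr T pR w = K_H kH *v (pRr T - pR) + fcr T + w"

text \<open>The time signal \<open>u'\<^sub>A\<close> generated by the references.\<close>

definition reference_input ::
  "real \<Rightarrow> (real \<Rightarrow> real^3) \<Rightarrow> (real \<Rightarrow> real^3) \<Rightarrow> real \<Rightarrow> real \<Rightarrow> real^3" where
  "reference_input kH pRr fcr T t = K_H kH *v (pRr t - pRr T) + fcr t - fcr T"


section \<open>Storage function\<close>

definition storage ::
  "real \<Rightarrow> real \<Rightarrow> real \<Rightarrow> real^3^3 \<Rightarrow> real \<Rightarrow> real^3 \<Rightarrow> real^3 \<Rightarrow> real \<Rightarrow> real \<Rightarrow>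
   state \<Rightarrow> real"
where
  "storage mH kc lbar MA kH pRrT fcrT lc0 V0 x =
     (let e = pRrT - p_R x
      in 1 / 2 * (mH * (v_H x \<bullet> v_H x) + v_R x \<bullet> (MA *v v_R x) + e \<bullet> (K_H kH *v e))
         + (LBINT \<tau>=lc0..norm (cable x). tension kc lbar \<tau>)
         - cable x \<bullet> fcrT + V0)"

end

theory Submission
  imports Defs
begin

text \<open>
  The gradient of the storage function is
  \<open>(f - f\<^sub>c, m\<^sub>H v\<^sub>H, f\<^sub>c - f - K\<^sub>H e, M\<^sub>A v\<^sub>R)\<close>, where \<open>f\<^sub>c\<close> is the cable force and \<open>f\<close> its final
  reference. Paired with the dynamics, all conservative terms cancel; \<open>f\<close> and the ground reaction
  are vertical and hence orthogonal to \<open>v\<^sub>H\<close>. What remains is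
  \<open>u \<bullet> y - v\<^sub>R \<bullet> B\<^sub>A v\<^sub>R - v\<^sub>H \<bullet> B\<^sub>H v\<^sub>H\<close>.
  Nonnegativity: by Cauchy-Schwarz the cable energy minus \<open>l\<^sub>c \<bullet> f\<close> is at least \<open>W s - f\<^sub>z s\<close>, where
  \<open>s = norm l\<^sub>c\<close> and \<open>W\<close> is the antiderivative of the tension. This convex function of \<open>s\<close> is
  minimal at the reference length \<open>lbar + f\<^sub>z / k\<^sub>c\<close>.
\<close>

section \<open>Elastic energy of the cable\<close>

text \<open>The antiderivative of the tension that vanishes at slack lengths, as a single formula
  across the kink at \<open>lbar\<close>.\<close>

definition elastic_energy :: "real \<Rightarrow> real \<Rightarrow> real \<Rightarrow> real" where
  "elastic_energy kc lbar l = kc / 2 * (max 0 (l - lbar))\<^sup>2"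

lemma tension_eq_max: "tension kc lbar l = kc * max 0 (l - lbar)"
  by (auto simp: tension_def max_def)

text \<open>Squaring smooths the kink: away from 0 the function is locally 0 or a square, and at 0
  the difference quotient is bounded by \<open>\<bar>h\<bar>\<close>.\<close>

lemma DERIV_max_zero_square: "((\<lambda>x::real. (max 0 x)\<^sup>2) has_real_derivative 2 * max 0 x) (at x)"
proof -
  consider "x < 0" | "x = 0" | "x > 0" by linarith
  then show ?thesis
  proof cases
    case 1
    have "((\<lambda>x::real. 0) has_real_derivative 0) (at x)" by simp
    then have "((\<lambda>x::real. (max 0 x)\<^sup>2) has_real_derivative 0) (at x)"
      by (rule has_field_derivative_transform_within_open[of _ _ _ "{..<0}"]) (use 1 in auto)
    then show ?thesis using 1 by simp
  next
    case 2
    have "((\<lambda>h::real. (max 0 h)\<^sup>2 / h) \<longlongrightarrow> 0) (at 0)"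
    proof (rule Lim_null_comparison)
      show "\<forall>\<^sub>F h::real in at 0. norm ((max 0 h)\<^sup>2 / h) \<le> \<bar>h\<bar>"
        by (auto simp: max_def power2_eq_square intro!: always_eventually)
      show "((\<lambda>h::real. \<bar>h\<bar>) \<longlongrightarrow> 0) (at 0)"
        by (rule tendsto_eq_intros | simp)+
    qed
    then show ?thesis using 2 by (simp add: DERIV_def)
  next
    case 3
    have "((\<lambda>x::real. x\<^sup>2) has_real_derivative 2 * x) (at x)"
      by (auto intro!: derivative_eq_intros)
    then have "((\<lambda>x::real. (max 0 x)\<^sup>2) has_real_derivative 2 * x) (at x)"
      by (rule has_field_derivative_transform_within_open[of _ _ _ "{0<..}"]) (use 3 in auto)
    then show ?thesis using 3 by simp
  qed
qed

lemma DERIV_elastic_energy: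
  "(elastic_energy kc lbar has_real_derivative tension kc lbar l) (at l)"
proof -
  have "((\<lambda>l. (max 0 (l - lbar))\<^sup>2) has_real_derivative 2 * max 0 (l - lbar) * 1) (at l)"
    by (rule DERIV_chain2[OF DERIV_max_zero_square]) (auto intro!: derivative_eq_intros)
  from DERIV_cmult[OF this, of "kc / 2"] show ?thesis
    by (simp add: elastic_energy_def[abs_def] tension_eq_max)
qed

text \<open>Valid for either order of the endpoints, so \<open>lc0\<close> enters the storage
  function only through an additive constant.\<close>

lemma interval_integral_tension:
  "(LBINT \<tau>=a..b. tension kc lbar \<tau>) = elastic_energy kc lbar b - elastic_energy kc lbar a"
proof (rule interval_integral_FTC_finite)
  show "continuous_on {min a b..max a b} (tension kc lbar)"
    unfolding tension_eq_max[abs_def] by (intro continuous_intros)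
  show "(elastic_energy kc lbar has_vector_derivative tension kc lbar x)
      (at x within {min a b..max a b})" for x
    using DERIV_elastic_energy
    by (metis has_field_derivative_at_within has_real_derivative_iff_has_vector_derivative)
qed

text \<open>At length \<open>lbar + f / kc\<close> the tension equals \<open>f\<close>. For slack
  lengths the energy is 0 and the linear term is monotone; for taut lengths the difference is a
  completed square.\<close>

lemma elastic_energy_minus_linear_ge:
  assumes "kc > 0" "f \<ge> 0"
  shows "elastic_energy kc lbar (lbar + f / kc) - f * (lbar + f / kc)
    \<le> elastic_energy kc lbar s - f * s"
proof -
  have *: "elastic_energy kc lbar (lbar + f / kc) - f * (lbar + f / kc) = - f\<^sup>2 / (2 * kc) - f * lbar"
    using assms by (simp add: elastic_energy_def max_def field_simps power2_eq_square)
  show ?thesis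
  proof (cases "s \<le> lbar")
    case True
    then have "f * s \<le> f * lbar" "0 \<le> f\<^sup>2 / (2 * kc)" "elastic_energy kc lbar s = 0"
      using assms by (auto simp: elastic_energy_def mult_left_mono)
    then show ?thesis unfolding * by simp
  next
    case False
    then have "elastic_energy kc lbar s - f * s - (- f\<^sup>2 / (2 * kc) - f * lbar)
        = (kc * (s - lbar) - f)\<^sup>2 / (2 * kc)"
      using assms by (simp add: elastic_energy_def max_def field_simps power2_eq_square)
    moreover have "0 \<le> (kc * (s - lbar) - f)\<^sup>2 / (2 * kc)" using assms by simp
    ultimately show ?thesis unfolding * by linarith
  qed
qed

text \<open>This form of the cable force has no singularity at \<open>l = 0\<close>.\<close>

lemma cable_force_eq:
  assumes "lbar > 0"
  shows "cable_force kc lbar l = (kc * (1 - lbar / max lbar (norm l))) *\<^sub>R l"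
  using assms by (cases "l = 0") (auto simp: cable_force_def tension_def max_def field_simps)

text \<open>The denominator \<open>max lbar (norm l)\<close> is at least \<open>lbar\<close> and so
  never vanishes.\<close>

lemma continuous_on_cable_force:
  assumes "lbar > 0"
  shows "continuous_on S (cable_force kc lbar)"
  unfolding cable_force_eq[OF assms, abs_def]
  using assms by (intro continuous_intros) (auto simp: max_def)

text \<open>The norm is not differentiable at 0, but the energy is identically 0 on the ball of
  radius \<open>lbar\<close>; elsewhere the chain rule applies.\<close>

lemma has_derivative_elastic_energy_norm:
  assumes "lbar > 0"
  shows "((\<lambda>l. elastic_energy kc lbar (norm l)) has_derivative (\<lambda>h. cable_force kc lbar l \<bullet> h)) (at l)"
proof (cases "l = 0")
  case True
  have "((\<lambda>l::real^3. 0::real) has_derivative (\<lambda>h. 0)) (at l)" by simp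
  then have "((\<lambda>l. elastic_energy kc lbar (norm l)) has_derivative (\<lambda>h::real^3. 0)) (at l)"
    by (rule has_derivative_transform_within_open[of _ _ _ _ "ball 0 lbar"])
      (use True assms in \<open>auto simp: elastic_energy_def\<close>)
  then show ?thesis using True by (simp add: cable_force_def)
next
  case False
  have "(norm has_derivative (\<lambda>h. h \<bullet> sgn l)) (at l)"
    using has_derivative_norm[OF False] by (simp add: inner_commute)
  from DERIV_elastic_energy[unfolded has_field_derivative_def, of kc lbar "norm l",
      THEN has_derivative_compose[OF this]]
  show ?thesis by (simp add: cable_force_def sgn_div_norm inner_commute mult.assoc)
qed

section \<open>Matrices\<close>

lemma diagonal_inner_commute:
  assumes "diagonal A"
  shows "x \<bullet> (A *v y) = y \<bullet> (A *v x)"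
proof -
  have "transpose A = A"
    using assms by (auto simp: transpose_def diagonal_def vec_eq_iff) metis
  then show ?thesis by (metis dot_lmul_matrix inner_commute transpose_matrix_vector)
qed

lemma diagonal_K_H: "diagonal (K_H k)"
  by (auto simp: diagonal_def K_H_def forall_3)

lemma K_H_nonneg: "k \<ge> 0 \<Longrightarrow> 0 \<le> x \<bullet> (K_H k *v x)"
  by (simp add: K_H_def inner_vec_def matrix_vector_mult_def sum_3 mult.left_commute[of _ k])

text \<open>If \<open>A *v x = 0\<close> then \<open>x \<bullet> (A *v x) = 0\<close>, so the kernel
  is trivial and the square matrix \<open>A\<close> is invertible.\<close>

lemma pos_def_mult_matrix_inv:
  assumes "pos_def A"
  shows "A *v (matrix_inv A *v x) = x"
proof -
  have "invertible A"
    unfolding invertible_left_inverse matrix_left_invertible_ker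
    using assms by (metis inner_zero_right less_irrefl pos_def_def)
  then have "A ** matrix_inv A = mat 1"
    unfolding invertible_def matrix_inv_def by (metis (mono_tags, lifting) someI_ex)
  then show ?thesis
    by (simp add: matrix_vector_mul_assoc)
qed

text \<open>The product rule yields two terms, which agree because a diagonal matrix is
  symmetric.\<close>

lemma has_derivative_diagonal_quadratic:
  assumes "diagonal A" "(f has_derivative f') (at x within S)"
  shows "((\<lambda>x. f x \<bullet> (A *v f x)) has_derivative (\<lambda>h. 2 * ((A *v f x) \<bullet> f' h))) (at x within S)"
proof -
  have "((\<lambda>x. A *v f x) has_derivative (\<lambda>h. A *v f' h)) (at x within S)"
    by (rule bounded_linear.has_derivative[OF matrix_vector_mul_bounded_linear assms(2)])
  from has_derivative_inner[OF assms(2) this] show ?thesis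
    by (rule has_derivative_eq_rhs)
      (simp add: fun_eq_iff diagonal_inner_commute[OF assms(1), of "f x"] inner_commute)
qed

section \<open>The storage function\<close>

text \<open>With the derivative represented by a vector, its continuity can be checked
  componentwise.\<close>

definition storage_gradient ::
  "real \<Rightarrow> real \<Rightarrow> real \<Rightarrow> real^3^3 \<Rightarrow> real \<Rightarrow> real^3 \<Rightarrow> real^3 \<Rightarrow> state \<Rightarrow> state"
where
  "storage_gradient mH kc lbar MA kH pRrT fcrT x =
     (fcrT - cable_force kc lbar (cable x),
      mH *\<^sub>R v_H x,
      cable_force kc lbar (cable x) - fcrT - K_H kH *v (pRrT - p_R x),
      MA *v v_R x)"

lemma has_derivative_storage:
  assumes "lbar > 0" "diagonal MA"
  shows "(storage mH kc lbar MA kH pRrT fcrT lc0 V0 has_derivative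
    (\<lambda>h. storage_gradient mH kc lbar MA kH pRrT fcrT x \<bullet> h)) (at x)"
proof -
  have [derivative_intros]: "(cable has_derivative cable) (at x)"
    unfolding cable_def[abs_def] by (auto intro!: derivative_eq_intros)
  have E: "((\<lambda>x. elastic_energy kc lbar (norm (cable x))) has_derivative
      (\<lambda>h. cable_force kc lbar (cable x) \<bullet> cable h)) (at x)"
    by (rule has_derivative_compose[OF _ has_derivative_elastic_energy_norm[OF assms(1)]])
      (rule derivative_intros)
  have K: "((\<lambda>x. (pRrT - p_R x) \<bullet> (K_H kH *v (pRrT - p_R x))) has_derivative
      (\<lambda>h. 2 * ((K_H kH *v (pRrT - p_R x)) \<bullet> (- p_R h)))) (at x)"
    by (rule has_derivative_diagonal_quadratic[OF diagonal_K_H]) (auto intro!: derivative_eq_intros)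
  have M: "((\<lambda>x::state. v_R x \<bullet> (MA *v v_R x)) has_derivative
      (\<lambda>h. 2 * ((MA *v v_R x) \<bullet> v_R h))) (at x)"
    by (rule has_derivative_diagonal_quadratic[OF assms(2)]) (auto intro!: derivative_eq_intros)
  show ?thesis
    unfolding storage_def[abs_def] Let_def interval_integral_tension
    by (rule derivative_eq_intros E K M refl)+
      (simp add: fun_eq_iff storage_gradient_def inner_prod_def cable_def inner_commute
        algebra_simps)
qed

lemma continuous_on_storage_gradient:
  assumes "lbar > 0"
  shows "continuous_on S (storage_gradient mH kc lbar MA kH pRrT fcrT)"
proof -
  have "continuous_on S cable"
    unfolding cable_def[abs_def] by (intro continuous_intros)
  then have "continuous_on S (\<lambda>x. cable_force kc lbar (cable x))"
    by (rule continuous_on_compose2[OF continuous_on_cable_force[OF assms, of UNIV]]) simp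
  then show ?thesis
    unfolding storage_gradient_def[abs_def]
    by (intro continuous_intros bounded_linear.continuous_on[OF matrix_vector_mul_bounded_linear])
qed

text \<open>The kinetic and position error terms are nonnegative and vanish at the reference, which
  leaves the cable terms to compare.\<close>

lemma storage_at_reference_le:
  assumes "mH \<ge> 0" "kc > 0" "lbar > 0" "kH \<ge> 0" "pos_def MA"
    and f: "fcrT = fz *\<^sub>R z_W" "0 < fz"
    and ref: "pRrT = pHrT + (1 / kc + lbar / norm fcrT) *\<^sub>R fcrT"
  shows "storage mH kc lbar MA kH pRrT fcrT lc0 V0 (pHrT, 0, pRrT, 0)
    \<le> storage mH kc lbar MA kH pRrT fcrT lc0 V0 x"
proof -
  define l where "l = lbar + fz / kc"
  have z: "norm z_W = 1" "z_W \<bullet> z_W = 1"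
    by (simp_all add: z_W_def inner_axis_axis)
  have nf: "norm fcrT = fz" using f z by simp
  \<comment> \<open>The reference robot position stretches the cable exactly so far that its tension
    is \<open>fz\<close>.\<close>
  have cable_ref: "cable (pHrT, 0, pRrT, 0) = l *\<^sub>R z_W"
  proof -
    have "(1 / kc + lbar / fz) * fz = l" using f(2) by (simp add: l_def field_simps)
    then show ?thesis unfolding cable_def ref nf by (simp add: f(1))
  qed
  have norm_ref: "norm (cable (pHrT, 0, pRrT, 0)) = l"
    using assms(2,3) f(2) z by (simp add: cable_ref l_def)
  have lin_ref: "cable (pHrT, 0, pRrT, 0) \<bullet> fcrT = fz * l"
    using z by (simp add: cable_ref f(1))
  have "cable x \<bullet> fcrT \<le> fz * norm (cable x)"
    using norm_cauchy_schwarz[of "cable x" fcrT] by (simp add: nf mult.commute)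
  moreover have "elastic_energy kc lbar l - fz * l
      \<le> elastic_energy kc lbar (norm (cable x)) - fz * norm (cable x)"
    using assms(2) f(2) unfolding l_def by (intro elastic_energy_minus_linear_ge) auto
  ultimately have cable_energy: "elastic_energy kc lbar l - fz * l
      \<le> elastic_energy kc lbar (norm (cable x)) - cable x \<bullet> fcrT"
    by linarith
  have "0 \<le> v_R x \<bullet> (MA *v v_R x)"
    using assms(5) by (cases "v_R x = 0") (auto simp: pos_def_def less_imp_le)
  then have "0 \<le> 1 / 2 * (mH * (v_H x \<bullet> v_H x) + v_R x \<bullet> (MA *v v_R x)
      + (pRrT - p_R x) \<bullet> (K_H kH *v (pRrT - p_R x)))"
    using assms(1,4) by (intro mult_nonneg_nonneg add_nonneg_nonneg K_H_nonneg) auto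
  from add_mono[OF this cable_energy] show ?thesis
    unfolding storage_def Let_def interval_integral_tension norm_ref lin_ref
    by (simp add: algebra_simps del: times_divide_eq_left)
qed

text \<open>The value of the \<open>THE\<close>-term in the ground reaction is irrelevant: only its direction matters.\<close>

lemma human_power:
  assumes "mH \<noteq> 0" "z_W \<bullet> v = 0"
  shows "mH * (v \<bullet> human_acc mH g BH v fc (ground_reaction mH g BH v fc uH) uH)
    = v \<bullet> fc + v \<bullet> uH - v \<bullet> (BH *v v)"
proof -
  have "v \<bullet> z_W = 0" using assms(2) by (simp add: inner_commute)
  then show ?thesis
    using assms(1) by (simp add: human_acc_def ground_reaction_def inner_simps)
qed

lemma storage_gradient_plant:
  assumes "mH \<noteq> 0" "pos_def MA" "diagonal MA" "z_W \<bullet> v_H x = 0" "fcrT = fz *\<^sub>R z_W"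
  shows "storage_gradient mH kc lbar MA kH pRrT fcrT x \<bullet>
      plant mH g kc lbar BH MA BA x (K_H kH *v (pRrT - p_R x) + fcrT + w) uH
    = w \<bullet> v_R x + uH \<bullet> v_H x - v_R x \<bullet> (BA *v v_R x) - v_H x \<bullet> (BH *v v_H x)"
proof -
  have f: "fcrT \<bullet> v_H x = 0" using assms(4,5) by simp
  \<comment> \<open>Symmetry moves \<open>MA\<close> onto the other factor, where it cancels the
    inverse mass in the dynamics.\<close>
  have M: "(MA *v v_R x) \<bullet> (matrix_inv MA *v y) = v_R x \<bullet> y" for y
    by (metis assms(2,3) diagonal_inner_commute inner_commute pos_def_mult_matrix_inv)
  show ?thesis
    using f human_power[OF assms(1,4), of g BH "cable_force kc lbar (cable x)" uH]
    unfolding storage_gradient_def plant_def Let_def inner_Pair M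
    by (simp add: inner_simps inner_commute)
qed

theorem theorem4:
  fixes mH g kc lbar kH T fz lc0 V0 :: real
    and BH MA BA :: "real^3^3"
    and pHr fcr pRr :: "real \<Rightarrow> real^3"
    and x0 :: state
    and V :: "state \<Rightarrow> real"
    and F :: "state \<Rightarrow> (real^3) \<times> (real^3) \<Rightarrow> state"
  assumes "mH > 0" "g > 0" "kc > 0" "lbar > 0" "kH > 0"
    and "pos_def BH"
    and "pos_def MA" "diagonal MA"
    and "pos_def BA" "diagonal BA"
    and "T > 0"
    and fcr_nonzero: "\<forall>t\<in>{0..T}. fcr t \<noteq> 0"
    and pHr_ground: "z_W \<bullet> pHr T = 0"
    and fcr_final: "fcr T = fz *\<^sub>R z_W" "0 < fz" "fz < mH * g"
    and pRr_def: "\<forall>t\<in>{0..T}. pRr t = robot_ref kc lbar pHr fcr t"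
    and F_def: "\<And>x wA uH. F x (wA, uH) =
           plant mH g kc lbar BH MA BA x (control_law kH pRr fcr T (p_R x) wA) uH"
    and initial: "x0 \<in> state_space" "lc0 = norm (cable x0)"
    and V_def: "\<And>x. V x = storage mH kc lbar MA kH (pRr T) (fcr T) lc0 V0 x"
    and V0: "V (pHr T, 0, pRr T, 0) = 0"
  shows "output_strictly_passive state_space F (\<lambda>x. (v_R x, v_H x)) V \<and>
    (\<forall>t\<in>{0..T}. \<forall>x\<in>state_space. \<forall>uH.
       plant mH g kc lbar BH MA BA x
         (K_H kH *v (pRr T - p_R x) + fcr T
          + (K_H kH *v (pRr t - pRr T) + fcr t - fcr T)) uH
       = F x (reference_input kH pRr fcr T t, uH))"
proof
  have "T \<in> {0..T}" using \<open>T > 0\<close> by simp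
  then have ref: "pRr T = pHr T + (1 / kc + lbar / norm (fcr T)) *\<^sub>R fcr T"
    using pRr_def by (simp add: robot_ref_def)
  have V_eq: "V = storage mH kc lbar MA kH (pRr T) (fcr T) lc0 V0"
    using V_def by (rule ext)
  let ?G = "storage_gradient mH kc lbar MA kH (pRr T) (fcr T)"
  \<comment> \<open>The damping terms that remain in the power balance, in the order of the output
    \<open>(v_R, v_H)\<close>.\<close>
  let ?\<phi> = "\<lambda>y :: (real^3) \<times> (real^3). (BA *v fst y, BH *v snd y)"
  show "output_strictly_passive state_space F (\<lambda>x. (v_R x, v_H x)) V"
    unfolding output_strictly_passive_def
  proof (intro exI conjI allI impI ballI)
    show "(V has_derivative blinfun_apply (blinfun_inner_right (?G x))) (at x)" for x
      unfolding V_eq blinfun_inner_right.rep_eq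
      using \<open>lbar > 0\<close> \<open>diagonal MA\<close> by (rule has_derivative_storage)
    show "continuous_on UNIV (\<lambda>x. blinfun_inner_right (?G x))"
      using continuous_on_storage_gradient[OF \<open>lbar > 0\<close>]
      by (rule bounded_linear.continuous_on[OF bounded_linear_blinfun_inner_right])
    show "0 \<le> V x" for x
    proof -
      have "V (pHr T, 0, pRr T, 0) \<le> V x"
        unfolding V_eq using assms(1,3-5,7) fcr_final(1,2) ref
        by (intro storage_at_reference_le[where fz = fz]) auto
      then show ?thesis by (simp add: V0)
    qed
    show "0 < y \<bullet> ?\<phi> y" if "y \<noteq> 0" for y
    proof -
      have "0 < a \<bullet> (A *v a)" if "pos_def A" "a \<noteq> 0" for A :: "real^3^3" and a
        using that by (simp add: pos_def_def)
      then show ?thesis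
        using that \<open>pos_def BH\<close> \<open>pos_def BA\<close>
        \<comment> \<open>Only one component of \<open>y\<close> need be nonzero; a zero component
          contributes 0.\<close>
        by (cases y; cases "fst y = 0"; cases "snd y = 0") (auto simp: add_pos_pos zero_prod_def)
    qed
    show "blinfun_apply (blinfun_inner_right (?G x)) (F x u)
        \<le> u \<bullet> (v_R x, v_H x) - (v_R x, v_H x) \<bullet> ?\<phi> (v_R x, v_H x)"
      if "x \<in> state_space" for x u
    proof -
      obtain w uH where u: "u = (w, uH)" by fastforce
      have "z_W \<bullet> v_H x = 0" using that by (simp add: state_space_def)
      with assms(1,7,8) fcr_final(1) show ?thesis
        unfolding u F_def control_law_def blinfun_inner_right.rep_eq
        \<comment> \<open>The dissipation inequality holds with equality, for an arbitrary input
          \<open>w\<close>.\<close>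
        by (subst storage_gradient_plant) (auto simp: inner_Pair)
    qed
  qed
  show "\<forall>t\<in>{0..T}. \<forall>x\<in>state_space. \<forall>uH.
       plant mH g kc lbar BH MA BA x
         (K_H kH *v (pRr T - p_R x) + fcr T
          + (K_H kH *v (pRr t - pRr T) + fcr t - fcr T)) uH
       = F x (reference_input kH pRr fcr T t, uH)"
    by (simp add: F_def control_law_def reference_input_def)
qed

end
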